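(* For every $\theta>1$ there exists $\gamma(\theta)>0$ such that the following holds. Let $\ell=\ell(n)$ be even with $\ell\sim 2\theta n$, and let $(\tau_1,\dots,\tau_\ell)$ be chosen uniformly at random among all $\ell$-tuples of transpositions of $\mathfrak S_n$ with $\tau_1\cdots\tau_\ell=\mathrm{id}$ (equivalently, a uniformly random pure Hurwitz map with $n$ vertices and $\ell$ edges). Then with probability tending to $1$ as $n\to\infty$ the associated map has a connected component with at least $\gamma(\theta)\ell$ edges. Moreover, the largest connected component has $O_p(n/\log n)$ vertices.
   Context: A tuple of transpositions $(\tau_1,\dots,\tau_\ell)$ in $\mathfrak S_n$ corresponds to a Hurwitz map: a multigraph on vertex set $\{1,\dots,n\}$ with edges labelled $1,\dots,\ell$, edge $k$ joining the two points swapped by $\tau_k$, embedded on an oriented (not necessarily connected) surface so that edge labels increase counterclockwise around each vertex; the map is pure iff $\tau_1\cdots\tau_\ell=\mathrm{id}$. Connected components of the map are the connected components of this multigraph (orbits of the group generated by the $\tau_k$); the number of edges of a component is the number of indices $k$ with $\tau_k$ acting inside it. $X_n=O_p(a_n)$ means $X_n/a_n$ is tight (bounded in probability). *)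

theory Defs
  imports "HOL-Probability.Probability" "HOL-Combinatorics.Transposition"
    "HOL-Library.Landau_Symbols"
begin

definition transpositions :: "nat \<Rightarrow> (nat \<Rightarrow> nat) set" where
  "transpositions n = {Transposition.transpose a b | a b. a \<in> {1..n} \<and> b \<in> {1..n} \<and> a \<noteq> b}"

text \<open>
  Tuples are lists, so the label of an edge is its list position, starting at 0.  The two
  conventions for multiplying permutations give the same set, since transpositions are involutions.
\<close>

definition pure_tuples :: "nat \<Rightarrow> nat \<Rightarrow> (nat \<Rightarrow> nat) list set" where
  "pure_tuples n l =
     {\<tau>s. length \<tau>s = l \<and> set \<tau>s \<subseteq> transpositions n \<and> foldr (\<circ>) \<tau>s id = id}"

lemma finite_pure_tuples: "finite (pure_tuples n l)"
proof -
  have "transpositions n =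
      (\<lambda>(a, b). Transposition.transpose a b) ` {(a, b) \<in> {1..n} \<times> {1..n}. a \<noteq> b}"
    by (auto simp: transpositions_def)
  moreover have "finite {(a, b) \<in> {1..n} \<times> {1..n}. a \<noteq> b}"
    by (rule finite_subset[of _ "{1..n} \<times> {1..n}"]) auto
  ultimately have "finite (transpositions n)"
    by simp
  then have "finite {\<tau>s. set \<tau>s \<subseteq> transpositions n \<and> length \<tau>s = l}"
    by (rule finite_lists_length_eq)
  then show ?thesis
    by (rule rev_finite_subset) (auto simp: pure_tuples_def)
qed

lemma pure_tuples_nonempty:
  assumes "n \<ge> 2" "even l"
  shows "pure_tuples n l \<noteq> {}"
proof -
  let ?t = "Transposition.transpose (1::nat) 2"
  obtain k where k: "l = 2 * k"
    using assms(2) by blast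
  have "foldr (\<circ>) (replicate (2 * k) ?t) id = id"
  proof (induction k)
    case (Suc k)
    then show ?case
      by (simp flip: o_assoc)
  qed simp
  moreover have "?t \<in> transpositions n"
    unfolding transpositions_def using assms(1) by force
  ultimately have "replicate l ?t \<in> pure_tuples n l"
    by (auto simp: pure_tuples_def k)
  then show ?thesis
    by blast
qed

text \<open>
  By the two lemmas above the uniform distribution is well defined for \<open>n \<ge> 2\<close> and even \<open>l\<close>.
  For the remaining \<open>n\<close> it may be an unspecified distribution, which does not affect
  statements about \<open>n \<rightarrow> \<infinity>\<close>, nor tightness.
\<close>

definition random_pure_tuple :: "nat \<Rightarrow> nat \<Rightarrow> (nat \<Rightarrow> nat) list pmf" where
  "random_pure_tuple n l = pmf_of_set (pure_tuples n l)"

text \<open>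
  The cyclic order of the edges around each vertex of the Hurwitz map is determined by the edge
  labels, so the map is represented by its edge-labelled multigraph.
\<close>

definition edge_ends :: "(nat \<Rightarrow> nat) list \<Rightarrow> nat \<Rightarrow> nat set" where
  "edge_ends \<tau>s k = {x. (\<tau>s ! k) x \<noteq> x}"

definition map_adj :: "(nat \<Rightarrow> nat) list \<Rightarrow> (nat \<times> nat) set" where
  "map_adj \<tau>s = {(x, y). x \<noteq> y \<and> (\<exists>k<length \<tau>s. edge_ends \<tau>s k = {x, y})}"

definition map_components :: "nat \<Rightarrow> (nat \<Rightarrow> nat) list \<Rightarrow> nat set set" where
  "map_components n \<tau>s = {1..n} // (map_adj \<tau>s)\<^sup>*"

definition component_edges :: "(nat \<Rightarrow> nat) list \<Rightarrow> nat set \<Rightarrow> nat set" where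
  "component_edges \<tau>s C = {k. k < length \<tau>s \<and> edge_ends \<tau>s k \<subseteq> C}"

definition max_component_vertices :: "nat \<Rightarrow> (nat \<Rightarrow> nat) list \<Rightarrow> nat" where
  "max_component_vertices n \<tau>s = Max (card ` map_components n \<tau>s)"

text \<open>
  The random variables \<open>X n\<close> may live on different probability spaces \<open>p n\<close>.  Where \<open>a n = 0\<close>
  the quotient is 0; finitely many such \<open>n\<close> do not matter, as a single law on the reals is tight.
\<close>

definition big_O_in_prob ::
    "(nat \<Rightarrow> 'a pmf) \<Rightarrow> (nat \<Rightarrow> 'a \<Rightarrow> real) \<Rightarrow> (nat \<Rightarrow> real) \<Rightarrow> bool" where
  "big_O_in_prob p X a \<longleftrightarrow> tight (\<lambda>n. distr (measure_pmf (p n)) borel (\<lambda>\<omega>. X n \<omega> / a n))"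

end

theory Submission
  imports Defs "HOL-Real_Asymp.Real_Asymp"
begin

text \<open>
  Everything is compared with \<open>(n / ln n) ^ (2 l)\<close>, up to factors \<open>exp (O(n))\<close>. Concentrating all
  edges on about \<open>n / ln n\<close> vertices and applying Cauchy--Schwarz to walks of length \<open>l / 2\<close> in the
  symmetric group shows that there are at least that many pure tuples. Conversely, consider tuples
  moving exactly the points of a set \<open>U\<close> of size \<open>m\<close>. The last edge at a vertex is determined by
  that vertex and the earlier edges, so purity costs a factor of at least \<open>m powr (m / 2)\<close>; hence
  \<open>m\<close> is at most of order \<open>n / ln n\<close> outside an exponentially small set. For such \<open>m\<close> there are
  only \<open>exp (O(n))\<close> ways to partition \<open>U\<close> into components, and given the partition, requiring all
  components to have at most \<open>\<gamma> l\<close> edges costs a factor \<open>\<gamma> ^ l\<close> by an entropy inequality,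
  which beats \<open>exp (O(n))\<close> when \<open>\<gamma>\<close> is small.
\<close>

section \<open>Transpositions and their products\<close>

text \<open>The points moved by at least one of the transpositions, not by their product: these are
  the vertices of positive degree.\<close>

definition moved_points :: "(nat \<Rightarrow> nat) list \<Rightarrow> nat set" where
  "moved_points \<tau>s = (\<Union>k<length \<tau>s. edge_ends \<tau>s k)"

lemma moved_set_transpose: "a \<noteq> b \<Longrightarrow> {x. Transposition.transpose a b x \<noteq> x} = {a, b}"
  by (auto simp: Transposition.transpose_def)

lemma finite_transpositions: "finite (transpositions n)"
proof -
  have "transpositions n \<subseteq> (\<lambda>(a, b). Transposition.transpose a b) ` ({1..n} \<times> {1..n})"
    by (auto simp: transpositions_def)
  then show ?thesis
    by (rule finite_subset) auto
qed

lemma transpositions_mono: "m \<le> n \<Longrightarrow> transpositions m \<subseteq> transpositions n"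
  unfolding transpositions_def by fastforce

lemma transpositions_permutes: "\<tau> \<in> transpositions n \<Longrightarrow> \<tau> permutes {1..n}"
  by (auto simp: transpositions_def intro: permutes_swap_id)

text \<open>A transposition is determined by the two points it moves, and every pair in
  \<open>{1..n}\<close> occurs.\<close>

lemma card_transpositions: "card (transpositions n) = n choose 2"
proof -
  have "bij_betw (\<lambda>\<tau>. {x. \<tau> x \<noteq> x}) (transpositions n) {B. B \<subseteq> {1..n} \<and> card B = 2}"
  proof (rule bij_betwI')
    fix \<sigma> \<tau> assume "\<sigma> \<in> transpositions n" "\<tau> \<in> transpositions n"
    then obtain a b c d where "\<sigma> = Transposition.transpose a b" "\<tau> = Transposition.transpose c d"
      "a \<noteq> b" "c \<noteq> d"
      by (auto simp: transpositions_def)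
    then have "{x. \<sigma> x \<noteq> x} = {x. \<tau> x \<noteq> x} \<Longrightarrow> \<sigma> = \<tau>"
      by (auto simp: moved_set_transpose doubleton_eq_iff transpose_commute)
    then show "{x. \<sigma> x \<noteq> x} = {x. \<tau> x \<noteq> x} \<longleftrightarrow> \<sigma> = \<tau>"
      by blast
  next
    fix \<tau> assume "\<tau> \<in> transpositions n"
    then obtain a b where "\<tau> = Transposition.transpose a b" "a \<noteq> b" "a \<in> {1..n}" "b \<in> {1..n}"
      by (auto simp: transpositions_def)
    then show "{x. \<tau> x \<noteq> x} \<in> {B. B \<subseteq> {1..n} \<and> card B = 2}"
      by (simp add: moved_set_transpose)
  next
    fix B assume B: "B \<in> {B. B \<subseteq> {1..n} \<and> card B = 2}"
    then obtain a b where "B = {a, b}" "a \<noteq> b"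
      by (auto simp: card_2_iff)
    with B show "\<exists>\<tau>\<in>transpositions n. B = {x. \<tau> x \<noteq> x}"
      by (intro bexI[of _ "Transposition.transpose a b"])
        (auto simp: moved_set_transpose transpositions_def)
  qed
  then show ?thesis
    by (simp add: bij_betw_same_card n_subsets)
qed

lemma foldr_comp_append: "foldr (\<circ>) (xs @ ys) id = foldr (\<circ>) xs id \<circ> foldr (\<circ>) ys id"
  by (induction xs) (simp_all add: comp_assoc)

lemma foldr_comp_permutes:
  "set \<tau>s \<subseteq> transpositions n \<Longrightarrow> foldr (\<circ>) \<tau>s id permutes {1..n}"
proof (induction \<tau>s)
  case (Cons \<tau> \<tau>s)
  have "foldr (\<circ>) \<tau>s id permutes {1..n}"
    by (rule Cons.IH) (use Cons.prems in auto)
  moreover have "\<tau> permutes {1..n}"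
    by (rule transpositions_permutes) (use Cons.prems in auto)
  ultimately have "\<tau> \<circ> foldr (\<circ>) \<tau>s id permutes {1..n}"
    by (rule permutes_compose)
  moreover have "foldr (\<circ>) (\<tau> # \<tau>s) id = \<tau> \<circ> foldr (\<circ>) \<tau>s id"
    by simp
  ultimately show ?case
    by metis
qed (simp add: permutes_id)

lemma foldr_comp_fixes: "(\<And>\<tau>. \<tau> \<in> set \<tau>s \<Longrightarrow> \<tau> x = x) \<Longrightarrow> foldr (\<circ>) \<tau>s id x = x"
  by (induction \<tau>s) auto

text \<open>Transpositions are involutions, so reversing a word inverts its product: the factors
  cancel from the middle outwards. This is what closes a walk when a second one is run
  backwards.\<close>

lemma foldr_comp_rev:
  assumes "set \<tau>s \<subseteq> transpositions n"
  shows "foldr (\<circ>) \<tau>s id \<circ> foldr (\<circ>) (rev \<tau>s) id = id"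
  using assms
proof (induction \<tau>s)
  case (Cons \<tau> \<tau>s)
  have "\<tau> \<circ> \<tau> = id"
    using Cons.prems by (auto simp: transpositions_def)
  moreover have "foldr (\<circ>) (\<tau> # \<tau>s) id \<circ> foldr (\<circ>) (rev (\<tau> # \<tau>s)) id =
      \<tau> \<circ> (foldr (\<circ>) \<tau>s id \<circ> foldr (\<circ>) (rev \<tau>s) id) \<circ> \<tau>"
    by (simp add: foldr_comp_append comp_assoc del: foldr_append)
  moreover have "foldr (\<circ>) \<tau>s id \<circ> foldr (\<circ>) (rev \<tau>s) id = id"
    by (rule Cons.IH) (use Cons.prems in auto)
  ultimately show ?case
    by (metis comp_id)
qed simp

section \<open>Lower bound for the number of pure tuples\<close>

text \<open>
  Cauchy--Schwarz for the number of ways to reach each permutation in half of the steps: two such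
  ways with the same end point combine to a closed walk.
\<close>

lemma card_pure_tuples_ge:
  assumes "even l" "q \<le> n"
  shows "(q choose 2) ^ l \<le> card (pure_tuples n l) * fact q"
proof -
  obtain h where l: "l = 2 * h"
    using assms(1) by blast
  define T where "T = {\<tau>s. set \<tau>s \<subseteq> transpositions q \<and> length \<tau>s = h}"
  define S where "S = {\<sigma>. \<sigma> permutes {1..q}}"
  define W where "W \<sigma> = {\<tau>s \<in> T. foldr (\<circ>) \<tau>s id = \<sigma>}" for \<sigma>
  have finT: "finite T" and cardT: "card T = (q choose 2) ^ h"
    unfolding T_def using finite_transpositions
    by (auto simp: card_lists_length_eq card_transpositions intro: finite_lists_length_eq)
  have finS: "finite S" and cardS: "card S = fact q"
    unfolding S_def by (auto simp: card_permutations finite_permutations)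
  have finW: "finite (W \<sigma>)" for \<sigma>
    using finT by (simp add: W_def)
  have "T = (\<Union>\<sigma>\<in>S. W \<sigma>)"
    using foldr_comp_permutes by (auto simp: W_def S_def T_def simp del: One_nat_def)
  then have "card T = (\<Sum>\<sigma>\<in>S. card (W \<sigma>))"
    using card_UN_disjoint[of S W] finS finW by (auto simp: W_def)
  moreover have "(\<Sum>\<sigma>\<in>S. real (card (W \<sigma>)))\<^sup>2 \<le> (\<Sum>\<sigma>\<in>S. (real (card (W \<sigma>)))\<^sup>2) * real (card S)"
    by (rule sum_squared_le_sum_of_squares)
  ultimately have CS: "(real (card T))\<^sup>2 \<le> (\<Sum>\<sigma>\<in>S. (real (card (W \<sigma>)))\<^sup>2) * fact q"
    by (simp add: cardS)
  \<comment> \<open>Pairs of walks with a common end point. Both have length \<open>h\<close>, so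
    cutting \<open>s @ rev t\<close> in the middle recovers \<open>s\<close> and \<open>t\<close>,
    and \<open>s\<close> determines \<sigma>; hence distinct pairs give distinct pure
    tuples.\<close>
  let ?D = "SIGMA \<sigma>:S. W \<sigma> \<times> W \<sigma>"
  have "card ?D \<le> card (pure_tuples n l)"
  proof (rule card_inj_on_le)
    show "inj_on (\<lambda>(\<sigma>, s, t). s @ rev t) ?D"
      by (auto simp: inj_on_def W_def T_def)
    show "(\<lambda>(\<sigma>, s, t). s @ rev t) ` ?D \<subseteq> pure_tuples n l"
    proof safe
      fix \<sigma> s t assume "s \<in> W \<sigma>" "t \<in> W \<sigma>"
      then have st: "set s \<subseteq> transpositions q" "set t \<subseteq> transpositions q"
        "length s = h" "length t = h" "foldr (\<circ>) s id = foldr (\<circ>) t id"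
        by (simp_all add: W_def T_def)
      have "foldr (\<circ>) (s @ rev t) id = id"
        unfolding foldr_comp_append st(5) by (rule foldr_comp_rev[OF st(2)])
      moreover have "set (s @ rev t) \<subseteq> transpositions n"
        using st(1,2) transpositions_mono[OF assms(2)] by auto
      moreover have "length (s @ rev t) = l"
        using st(3,4) l by simp
      ultimately show "s @ rev t \<in> pure_tuples n l"
        unfolding pure_tuples_def by blast
    qed
  qed (rule finite_pure_tuples)
  moreover have "card ?D = (\<Sum>\<sigma>\<in>S. (card (W \<sigma>))\<^sup>2)"
    using finS finW by (simp add: power2_eq_square)
  ultimately have "(\<Sum>\<sigma>\<in>S. (real (card (W \<sigma>)))\<^sup>2) \<le> real (card (pure_tuples n l))"
    by (metis (no_types, lifting) of_nat_le_iff of_nat_power of_nat_sum sum.cong)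
  then have "(real (card T))\<^sup>2 \<le> real (card (pure_tuples n l)) * fact q"
    using CS by (meson fact_ge_zero mult_right_mono order_trans)
  then have "real ((q choose 2) ^ l) \<le> real (card (pure_tuples n l) * fact q)"
    by (simp add: cardT l power_even_eq)
  then show ?thesis
    by linarith
qed

section \<open>Upper bound for tuples with prescribed moved points\<close>

text \<open>Induction on the length: each admissible prefix has at most \<open>c l\<close>
  extensions. The candidates at position \<open>j\<close> may depend on the whole prefix, because a
  last edge is computed from all the earlier ones; only their number must be bounded
  uniformly.\<close>

lemma card_lists_dependent_le:
  fixes F :: "nat \<Rightarrow> 'a list \<Rightarrow> 'a set" and c :: "nat \<Rightarrow> nat"
  assumes "\<And>j ys. finite (F j ys)" "\<And>j ys. card (F j ys) \<le> c j"
  shows "finite {xs. length xs = l \<and> (\<forall>j<l. xs ! j \<in> F j (take j xs))} \<and>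
    card {xs. length xs = l \<and> (\<forall>j<l. xs ! j \<in> F j (take j xs))} \<le> (\<Prod>j<l. c j)"
proof (induction l)
  case 0
  have "{xs. length xs = 0 \<and> (\<forall>j<0. xs ! j \<in> F j (take j xs))} = {[]}"
    by auto
  then show ?case
    by simp
next
  case (Suc l)
  define A where "A = {xs. length xs = l \<and> (\<forall>j<l. xs ! j \<in> F j (take j xs))}"
  let ?B = "{xs. length xs = Suc l \<and> (\<forall>j<Suc l. xs ! j \<in> F j (take j xs))}"
  have A: "finite A" "card A \<le> (\<Prod>j<l. c j)"
    using Suc by (simp_all add: A_def)
  have sub: "?B \<subseteq> (\<lambda>(ys, x). ys @ [x]) ` (SIGMA ys:A. F l ys)"
  proof
    fix xs assume xs: "xs \<in> ?B"
    then have "xs = take l xs @ [xs ! l]"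
      by (metis (mono_tags, lifting) lessI mem_Collect_eq order_refl take_Suc_conv_app_nth take_all)
    moreover have "take l xs \<in> A"
      using xs by (auto simp: A_def min_absorb1)
    moreover have "xs ! l \<in> F l (take l xs)"
      using xs by auto
    ultimately show "xs \<in> (\<lambda>(ys, x). ys @ [x]) ` (SIGMA ys:A. F l ys)"
      by (intro image_eqI[of _ _ "(take l xs, xs ! l)"]) auto
  qed
  have fin: "finite (SIGMA ys:A. F l ys)"
    using A assms by auto
  then have "card ?B \<le> card (SIGMA ys:A. F l ys)"
    using sub by (meson card_image_le card_mono finite_imageI le_trans)
  also have "\<dots> = (\<Sum>ys\<in>A. card (F l ys))"
    using A assms by auto
  also have "\<dots> \<le> (\<Sum>ys\<in>A. c l)"
    by (rule sum_mono) (rule assms)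
  also have "\<dots> \<le> (\<Prod>j<Suc l. c j)"
    using A by simp
  finally show ?case
    using sub fin by (meson finite_imageI finite_subset)
qed

lemma moved_points_subset: "\<tau>s \<in> pure_tuples n l \<Longrightarrow> moved_points \<tau>s \<subseteq> {1..n}"
  by (force simp: moved_points_def pure_tuples_def edge_ends_def transpositions_def
      moved_set_transpose in_set_conv_nth subset_iff Transposition.transpose_def split: if_splits)

lemma pure_tuples_nth:
  assumes "\<tau>s \<in> pure_tuples n l" "k < l"
  obtains a b where "\<tau>s ! k = Transposition.transpose a b" "a \<noteq> b" "edge_ends \<tau>s k = {a, b}"
proof -
  have "\<tau>s ! k \<in> transpositions n"
    using assms by (force simp: pure_tuples_def)
  then obtain a b where "\<tau>s ! k = Transposition.transpose a b" "a \<noteq> b"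
    by (auto simp: transpositions_def)
  then show thesis
    using that by (simp add: edge_ends_def moved_set_transpose)
qed

text \<open>Split the product at \<open>j\<close> into the earlier edges, the edge \<open>j\<close>
  and the later edges. The later ones fix \<open>v\<close>, so the earlier ones must carry the image
  of \<open>v\<close> under \<open>\<tau>s ! j\<close> back to \<open>v\<close>. This gives the
  other end point of the edge.\<close>

lemma last_edge_determined:
  assumes \<tau>s: "\<tau>s \<in> pure_tuples n l" and j: "j < l" and v: "v \<in> edge_ends \<tau>s j"
    and last: "\<And>i. j < i \<Longrightarrow> i < l \<Longrightarrow> v \<notin> edge_ends \<tau>s i"
  shows "\<tau>s ! j = Transposition.transpose v (inv (foldr (\<circ>) (take j \<tau>s) id) v)"
proof -
  let ?\<phi> = "foldr (\<circ>) (take j \<tau>s) id"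
  have len: "length \<tau>s = l" and tr: "set \<tau>s \<subseteq> transpositions n" and id: "foldr (\<circ>) \<tau>s id = id"
    using \<tau>s by (auto simp: pure_tuples_def)
  have "\<tau>s = take j \<tau>s @ [\<tau>s ! j] @ drop (Suc j) \<tau>s"
    using id_take_nth_drop[of j \<tau>s] j len by simp
  then have "?\<phi> \<circ> (\<tau>s ! j \<circ> foldr (\<circ>) (drop (Suc j) \<tau>s) id) = id"
    using id by (metis foldr_comp_append foldr_Cons foldr_Nil comp_id comp_apply)
  moreover have "foldr (\<circ>) (drop (Suc j) \<tau>s) id v = v"
  proof (rule foldr_comp_fixes)
    fix \<tau> assume "\<tau> \<in> set (drop (Suc j) \<tau>s)"
    then obtain i where "i < l - Suc j" "\<tau> = \<tau>s ! (Suc j + i)"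
      using len by (auto simp: in_set_conv_nth)
    then show "\<tau> v = v"
      using last[of "Suc j + i"] by (auto simp: edge_ends_def)
  qed
  ultimately have "?\<phi> ((\<tau>s ! j) v) = v"
    by (metis comp_apply id_apply)
  moreover have "bij ?\<phi>"
    using tr by (intro permutes_bij[OF foldr_comp_permutes[of _ n]]) (meson set_take_subset subset_trans)
  ultimately have "inv ?\<phi> v = (\<tau>s ! j) v"
    by (metis bij_inv_eq_iff)
  moreover obtain a b where "\<tau>s ! j = Transposition.transpose a b" "a \<noteq> b" "edge_ends \<tau>s j = {a, b}"
    using pure_tuples_nth[OF \<tau>s j] .
  ultimately show ?thesis
    using v by (auto simp: transpose_commute)
qed

text \<open>
  The last edge at \<open>v\<close> is determined by \<open>v\<close> and the earlier edges, which saves a factor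
  \<open>card U\<close>; an edge is the last one for at most two vertices.
\<close>

lemma card_pure_tuples_moved_points_le:
  assumes "finite U"
  shows "real (card {\<tau>s \<in> pure_tuples n l. moved_points \<tau>s = U})
    \<le> 2 ^ l * real (card U) ^ (2 * l) / sqrt (real (card U)) ^ card U"
proof (cases "U = {}")
  case True
  \<comment> \<open>Only the empty tuple moves nothing; for \<open>l = 0\<close> the bound equals 1
    since \<open>0 ^ 0 = 1\<close>.\<close>
  have "{\<tau>s \<in> pure_tuples n l. moved_points \<tau>s = U} \<subseteq> (if l = 0 then {[]} else {})"
    using True pure_tuples_nth[of _ n l 0] by (fastforce simp: moved_points_def pure_tuples_def)
  then have "card {\<tau>s \<in> pure_tuples n l. moved_points \<tau>s = U} \<le> card (if l = 0 then {[] :: (nat \<Rightarrow> nat) list} else {})"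
    by (intro card_mono) auto
  then show ?thesis
    using True by (cases "l = 0") auto
next
  case False
  define m where "m = card U"
  have m: "m > 0"
    using False assms by (auto simp: m_def card_gt_0_iff)
  \<comment> \<open>At a position in \<open>P\<close> it suffices to name the vertex for which the
    edge is the last one, which leaves at most \<open>m\<close> choices; elsewhere both end points
    are named, with at most \<open>m * m\<close> choices.\<close>
  define F where "F P j ys = (if j \<in> P
      then (\<lambda>v. Transposition.transpose v (inv (foldr (\<circ>) ys id) v)) ` U
      else (\<lambda>(a, b). Transposition.transpose a b) ` (U \<times> U))"
    for P :: "nat set" and j :: nat and ys :: "(nat \<Rightarrow> nat) list"
  define L where "L P = {\<tau>s. length \<tau>s = l \<and> (\<forall>j<l. \<tau>s ! j \<in> F P j (take j \<tau>s))}" for P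
  define c where "c P j = (if j \<in> P then m else m\<^sup>2)" for P :: "nat set" and j :: nat
  \<comment> \<open>The positions of the last edges are guessed first, which costs the factor
    \<open>2 ^ l\<close>. There are at least \<open>m / 2\<close> of them.\<close>
  define \<P> where "\<P> = {P. P \<subseteq> {..<l} \<and> m \<le> 2 * card P}"
  have finP: "finite \<P>" and cardP: "card \<P> \<le> 2 ^ l"
  proof -
    have "\<P> \<subseteq> Pow {..<l}"
      by (auto simp: \<P>_def)
    then show "finite \<P>" "card \<P> \<le> 2 ^ l"
      using finite_subset[of \<P> "Pow {..<l}"] card_mono[of "Pow {..<l}" \<P>] by (auto simp: card_Pow)
  qed
  have L: "finite (L P) \<and> card (L P) \<le> (\<Prod>j<l. c P j)" for P
    unfolding L_def
  proof (rule card_lists_dependent_le)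
    show "finite (F P j ys)" for j ys
      using assms by (simp add: F_def)
    show "card (F P j ys) \<le> c P j" for j ys
      using card_image_le[of U "\<lambda>v. Transposition.transpose v (inv (foldr (\<circ>) ys id) v)"]
        card_image_le[of "U \<times> U" "\<lambda>(a, b). Transposition.transpose a b"] assms
      by (auto simp: F_def c_def m_def card_cartesian_product power2_eq_square)
  qed
  have Lr: "real (card (L P)) \<le> real m ^ (2 * l) / sqrt (real m) ^ m" if P: "P \<in> \<P>" for P
  proof -
    have Pl: "P \<subseteq> {..<l}" and Pm: "m \<le> 2 * card P"
      using P by (auto simp: \<P>_def)
    have "real (\<Prod>j<l. c P j) = (\<Prod>j<l. (real m)\<^sup>2 * (if j \<in> P then 1 / real m else 1))"
      unfolding of_nat_prod using m by (intro prod.cong) (auto simp: c_def power2_eq_square)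
    also have "\<dots> = real m ^ (2 * l) * (\<Prod>j<l. if j \<in> P then 1 / real m else 1)"
      by (simp add: prod.distrib power_mult)
    also have "(\<Prod>j<l. if j \<in> P then 1 / real m else 1) = (1 / real m) ^ card P"
      using Pl by (simp add: prod.If_cases Int_absorb1)
    \<comment> \<open>Square roots allow \<open>m \<le> 2 * card P\<close> to be used without
      distinguishing the parity of \<open>m\<close>.\<close>
    also have "\<dots> = 1 / sqrt (real m) ^ (2 * card P)"
      by (simp add: power_mult power_one_over)
    also have "\<dots> \<le> 1 / sqrt (real m) ^ m"
      using m Pm by (intro divide_left_mono power_increasing) auto
    finally have "real (\<Prod>j<l. c P j) \<le> real m ^ (2 * l) / sqrt (real m) ^ m"
      using m by (simp add: mult_left_mono)
    then show ?thesis
      using L[of P] by linarith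
  qed
  have "{\<tau>s \<in> pure_tuples n l. moved_points \<tau>s = U} \<subseteq> (\<Union>P\<in>\<P>. L P)"
  proof
    fix \<tau>s assume "\<tau>s \<in> {\<tau>s \<in> pure_tuples n l. moved_points \<tau>s = U}"
    then have \<tau>s: "\<tau>s \<in> pure_tuples n l" and U: "moved_points \<tau>s = U"
      by auto
    have len: "length \<tau>s = l"
      using \<tau>s by (simp add: pure_tuples_def)
    define P where "P = {j. j < l \<and> (\<exists>v\<in>edge_ends \<tau>s j. \<forall>i. j < i \<and> i < l \<longrightarrow> v \<notin> edge_ends \<tau>s i)}"
    have sub: "edge_ends \<tau>s j \<subseteq> U" if "j < l" for j
      using that U len by (auto simp: moved_points_def)
    have ends: "finite (edge_ends \<tau>s j)" "card (edge_ends \<tau>s j) \<le> 2" if "j < l" for j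
      using pure_tuples_nth[OF \<tau>s that] by (metis finite.emptyI finite.insertI, metis card_2_iff order_refl)
    have finP: "finite P"
      by (auto simp: P_def)
    have "U \<subseteq> (\<Union>j\<in>P. edge_ends \<tau>s j)"
    proof
      fix v assume "v \<in> U"
      define I where "I = {j. j < l \<and> v \<in> edge_ends \<tau>s j}"
      have I: "finite I" "I \<noteq> {}"
        using \<open>v \<in> U\<close> U len by (auto simp: I_def moved_points_def)
      then have "Max I \<in> I"
        by (rule Max_in)
      moreover have "v \<notin> edge_ends \<tau>s i" if "Max I < i" "i < l" for i
        using that Max_ge[of I i] I by (auto simp: I_def)
      ultimately have "Max I \<in> P" "v \<in> edge_ends \<tau>s (Max I)"
        unfolding I_def P_def by blast+
      then show "v \<in> (\<Union>j\<in>P. edge_ends \<tau>s j)"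
        by blast
    qed
    then have "m \<le> card (\<Union>j\<in>P. edge_ends \<tau>s j)"
      unfolding m_def using finP ends by (intro card_mono) (auto simp: P_def)
    also have "\<dots> \<le> (\<Sum>j\<in>P. card (edge_ends \<tau>s j))"
      by (rule card_UN_le[OF finP])
    also have "\<dots> \<le> (\<Sum>j\<in>P. 2)"
      by (rule sum_mono) (auto simp: P_def ends)
    finally have "P \<in> \<P>"
      by (auto simp: \<P>_def P_def)
    moreover have "\<tau>s ! j \<in> F P j (take j \<tau>s)" if j: "j < l" for j
    proof (cases "j \<in> P")
      case True
      then obtain v where "v \<in> edge_ends \<tau>s j" "\<forall>i. j < i \<and> i < l \<longrightarrow> v \<notin> edge_ends \<tau>s i"
        by (auto simp: P_def)
      then show ?thesis
        using last_edge_determined[OF \<tau>s j] sub[OF j] True by (auto simp: F_def)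
    next
      case False
      obtain a b where "\<tau>s ! j = Transposition.transpose a b" "a \<noteq> b" "edge_ends \<tau>s j = {a, b}"
        using pure_tuples_nth[OF \<tau>s j] .
      then show ?thesis
        using sub[OF j] False by (auto simp: F_def)
    qed
    ultimately show "\<tau>s \<in> (\<Union>P\<in>\<P>. L P)"
      using len by (auto simp: L_def)
  qed
  then have "card {\<tau>s \<in> pure_tuples n l. moved_points \<tau>s = U} \<le> card (\<Union>P\<in>\<P>. L P)"
    using finP L by (intro card_mono) auto
  also have "\<dots> \<le> (\<Sum>P\<in>\<P>. card (L P))"
    by (rule card_UN_le[OF finP])
  finally have "real (card {\<tau>s \<in> pure_tuples n l. moved_points \<tau>s = U}) \<le> (\<Sum>P\<in>\<P>. real (card (L P)))"
    by (simp flip: of_nat_sum)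
  also have "\<dots> \<le> (\<Sum>P\<in>\<P>. real m ^ (2 * l) / sqrt (real m) ^ m)"
    by (rule sum_mono) (rule Lr)
  also have "\<dots> = real (card \<P>) * (real m ^ (2 * l) / sqrt (real m) ^ m)"
    by simp
  also have "\<dots> \<le> real (2 ^ l) * (real m ^ (2 * l) / sqrt (real m) ^ m)"
    using cardP by (intro mult_right_mono of_nat_mono) auto
  finally show ?thesis
    by (simp add: m_def)
qed

section \<open>An entropy inequality\<close>

text \<open>
  Gibbs' inequality for the block sizes against the block frequencies, via \<open>y \<le> exp (y - 1)\<close>.
\<close>

lemma prod_weights_le:
  fixes w :: "'b \<Rightarrow> real" and k :: "'a \<Rightarrow> 'b"
  assumes J: "finite J" "J \<noteq> {}" and w: "\<And>u. w u \<ge> 0" and m: "m > 0" "(\<Sum>u\<in>k ` J. w u) \<le> m"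
    and g: "\<And>u. u \<in> k ` J \<Longrightarrow> real (card {j \<in> J. k j = u}) \<le> g"
  shows "(\<Prod>j\<in>J. w (k j)) \<le> (m * g / real (card J)) ^ card J"
proof -
  define N where "N u = real (card {j \<in> J. k j = u})" for u
  define l where "l = real (card J)"
  have l: "l > 0"
    using J by (simp add: l_def card_gt_0_iff)
  have N: "N (k j) > 0" if "j \<in> J" for j
    using that J by (auto simp: N_def card_gt_0_iff)
  \<comment> \<open>The relative weight \<open>w (k j) / m\<close> of the class of \<open>j\<close>
    divided by its relative frequency \<open>N (k j) / l\<close>. Grouping by classes shows that
    these ratios have mean at most 1, since the \<open>N u\<close> indices of class \<open>u\<close>
    contribute \<open>w u\<close> in total before the factor \<open>l / m\<close>.\<close>
  define y where "y j = w (k j) * l / (m * N (k j))" for j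
  have "(\<Sum>j\<in>J. w (k j) / N (k j)) = (\<Sum>u\<in>k ` J. \<Sum>j | j \<in> J \<and> k j = u. w (k j) / N (k j))"
    using J(1) by (rule sum.image_gen)
  also have "\<dots> = (\<Sum>u\<in>k ` J. w u)"
  proof (rule sum.cong)
    fix u assume u: "u \<in> k ` J"
    have "(\<Sum>j | j \<in> J \<and> k j = u. w (k j) / N (k j)) = (\<Sum>j | j \<in> J \<and> k j = u. w u / N u)"
      by (rule sum.cong) auto
    also have "\<dots> = w u"
      using u N unfolding N_def by fastforce
    finally show "(\<Sum>j | j \<in> J \<and> k j = u. w (k j) / N (k j)) = w u" .
  qed simp
  finally have "(\<Sum>j\<in>J. w (k j) / N (k j)) \<le> m"
    using m by simp
  moreover have "(\<Sum>j\<in>J. y j) = (l / m) * (\<Sum>j\<in>J. w (k j) / N (k j))"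
    unfolding sum_distrib_left y_def by (rule sum.cong) (simp_all add: field_simps)
  ultimately have "(\<Sum>j\<in>J. y j) \<le> (l / m) * m"
    using l m by (metis divide_nonneg_pos less_imp_le mult_left_mono)
  then have y: "(\<Sum>j\<in>J. y j - 1) \<le> 0"
    using m by (simp add: sum_subtractf l_def)
  have "(\<Prod>j\<in>J. w (k j)) = (\<Prod>j\<in>J. y j * (m * N (k j) / l))"
    using m l N by (intro prod.cong) (auto simp: y_def dest: N)
  also have "\<dots> \<le> (\<Prod>j\<in>J. exp (y j - 1) * (m * g / l))"
  proof (intro prod_mono conjI mult_mono)
    fix j assume j: "j \<in> J"
    show "y j \<le> exp (y j - 1)"
      using exp_ge_add_one_self[of "y j - 1"] by simp
    show "m * N (k j) / l \<le> m * g / l"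
      using g[of "k j"] j m l by (simp add: N_def divide_right_mono)
    show "0 \<le> m * N (k j) / l"
      using m l N[OF j] by simp
    show "0 \<le> y j * (m * N (k j) / l)"
      using w l m N[OF j] by (simp add: y_def)
  qed simp
  also have "\<dots> = exp (\<Sum>j\<in>J. y j - 1) * (m * g / l) ^ card J"
    unfolding prod.distrib using J by (simp add: exp_sum)
  also have "\<dots> \<le> 1 * (m * g / l) ^ card J"
  proof (rule mult_right_mono)
    obtain j where "j \<in> J"
      using J by auto
    then have "g \<ge> 0"
      using N[of j] g[of "k j"] by (auto simp: N_def)
    then show "0 \<le> (m * g / l) ^ card J"
      using m l by simp
  qed (use y in simp)
  finally show ?thesis
    by (simp add: l_def)
qed

section \<open>Components and moved points\<close>

lemma map_adj_iff:
  "(x, y) \<in> map_adj \<tau>s \<longleftrightarrow> x \<noteq> y \<and> (\<exists>k<length \<tau>s. edge_ends \<tau>s k = {x, y})"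
  by (simp add: map_adj_def)

lemma sym_map_adj_rtrancl: "sym ((map_adj \<tau>s)\<^sup>*)"
  by (rule sym_rtrancl) (auto simp: sym_def map_adj_iff insert_commute)

text \<open>A nontrivial path to \<open>y\<close> ends with an edge at \<open>y\<close>, so
  \<open>y\<close> is moved; the trivial path accounts for \<open>x\<close> itself.\<close>

lemma component_subset: "(map_adj \<tau>s)\<^sup>* `` {x} \<subseteq> insert x (moved_points \<tau>s)"
proof
  fix y assume "y \<in> (map_adj \<tau>s)\<^sup>* `` {x}"
  then have "(x, y) \<in> (map_adj \<tau>s)\<^sup>*"
    by simp
  then show "y \<in> insert x (moved_points \<tau>s)"
    by (cases rule: rtranclE) (auto simp: map_adj_iff moved_points_def)
qed

text \<open>A nontrivial path from \<open>x\<close> would begin with an edge that moves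
  \<open>x\<close>.\<close>

lemma component_trivial:
  assumes "x \<notin> moved_points \<tau>s"
  shows "(map_adj \<tau>s)\<^sup>* `` {x} = {x}"
proof -
  have "y = x" if "(x, y) \<in> (map_adj \<tau>s)\<^sup>*" for y
    using that
    by (cases rule: converse_rtranclE) (use assms in \<open>auto simp: map_adj_iff moved_points_def\<close>)
  then show ?thesis
    by auto
qed

lemma component_eqI:
  assumes "(x, y) \<in> (map_adj \<tau>s)\<^sup>*"
  shows "(map_adj \<tau>s)\<^sup>* `` {x} = (map_adj \<tau>s)\<^sup>* `` {y}"
  using assms sym_map_adj_rtrancl[of \<tau>s] by (auto dest: symD intro: rtrancl_trans)

text \<open>The component of a moved point consists of moved points, and every other component is a
  singleton, which is why 1 enters the maximum. In this way a bound on the number of moved points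
  controls the largest component.\<close>

lemma max_component_vertices_le:
  assumes "n \<ge> 1" "finite (moved_points \<tau>s)"
  shows "max_component_vertices n \<tau>s \<le> max 1 (card (moved_points \<tau>s))"
proof -
  have "card C \<le> max 1 (card (moved_points \<tau>s))" if C_in: "C \<in> map_components n \<tau>s" for C
  proof -
    obtain x where C: "C = (map_adj \<tau>s)\<^sup>* `` {x}"
      using C_in by (auto simp: map_components_def quotient_def)
    show ?thesis
    proof (cases "x \<in> moved_points \<tau>s")
      case True
      then have "C \<subseteq> moved_points \<tau>s"
        using component_subset[of \<tau>s x] C by auto
      then show ?thesis
        using assms(2) by (simp add: card_mono le_max_iff_disj)
    qed (simp add: C component_trivial)
  qed
  moreover have "finite (map_components n \<tau>s)" "map_components n \<tau>s \<noteq> {}"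
    using assms(1) by (auto simp: map_components_def quotient_def)
  ultimately show ?thesis
    by (simp add: max_component_vertices_def)
qed

section \<open>Counting tuples all of whose components are small\<close>

definition small_components :: "nat \<Rightarrow> real \<Rightarrow> (nat \<Rightarrow> nat) list set" where
  "small_components n g = {\<tau>s. \<forall>C\<in>map_components n \<tau>s. real (card (component_edges \<tau>s C)) \<le> g}"

text \<open>
  A tuple is determined by a function \<open>r\<close> choosing a representative of each component, the list of
  first end points and the list of second end points; the latter lie in prescribed blocks.
\<close>

lemma card_small_components_le:
  assumes U: "finite U" "U \<noteq> {}" and l: "l > 0" and g: "g \<ge> 0"
  shows "real (card {\<tau>s \<in> pure_tuples n l. moved_points \<tau>s = U \<and> \<tau>s \<in> small_components n g})
    \<le> real (card U) ^ card U * real (card U) ^ l * (real (card U) * g / real l) ^ l"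
proof -
  define m where "m = card U"
  have m: "m > 0"
    using U by (simp add: m_def card_gt_0_iff)
  define b where "b r a = {v \<in> U. r v = r a}" for r :: "nat \<Rightarrow> nat" and a
  \<comment> \<open>For the \<open>r\<close> belonging to a tuple, both end points of an edge have
    the same representative. Sorting the edges by the representative of the first end point
    therefore sorts them by component, and the last condition expresses that each component has at
    most \<open>g\<close> edges.\<close>
  define A where "A r = {as. length as = l \<and> set as \<subseteq> U \<and>
      (\<forall>u. real (card {j. j < l \<and> r (as ! j) = u}) \<le> g)}" for r :: "nat \<Rightarrow> nat"
  define B where "B r as = {bs. length bs = l \<and> (\<forall>j<l. bs ! j \<in> b r (as ! j))}" for r as
  define R where "R = (U \<rightarrow>\<^sub>E U)"
  define f where "f = (\<lambda>(r :: nat \<Rightarrow> nat, as, bs). map2 Transposition.transpose as (bs :: nat list))"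
  have finR: "finite R" and cardR: "card R = m ^ m"
    using U by (auto simp: R_def m_def card_funcsetE intro: finite_PiE)
  have finA: "finite (A r)" and cardA: "card (A r) \<le> m ^ l" for r
  proof -
    have sub: "A r \<subseteq> {as. set as \<subseteq> U \<and> length as = l}"
      by (auto simp: A_def)
    then show "finite (A r)"
      using U finite_lists_length_eq finite_subset by blast
    show "card (A r) \<le> m ^ l"
      using card_mono[OF _ sub] U by (simp add: finite_lists_length_eq card_lists_length_eq m_def)
  qed
  have B: "finite (B r as) \<and> card (B r as) \<le> (\<Prod>j<l. card (b r (as ! j)))" for r as
    unfolding B_def using U
    by (intro card_lists_dependent_le[where F = "\<lambda>j ys. b r (as ! j)"]) (auto simp: b_def)
  have cardB: "real (card (B r as)) \<le> (real m * g / real l) ^ l" if as: "as \<in> A r" for r as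
  proof -
    \<comment> \<open>The entropy inequality is applied with the blocks of \<open>r\<close> as
      classes and their sizes as weights. The blocks are disjoint subsets of \<open>U\<close>, so
      the sizes add up to at most \<open>m\<close>, and the class frequencies are the edge numbers
      bounded by \<open>g\<close>.\<close>
    let ?k = "\<lambda>j. r (as ! j)" and ?w = "\<lambda>u. real (card {v \<in> U. r v = u})"
    have "(\<Prod>j\<in>{..<l}. ?w (?k j)) \<le> (real m * g / real (card {..<l})) ^ card {..<l}"
    proof (rule prod_weights_le[where k = ?k and w = ?w])
      have "(\<Sum>u\<in>?k ` {..<l}. ?w u) = real (card (\<Union>u\<in>?k ` {..<l}. {v \<in> U. r v = u}))"
        using U by (subst card_UN_disjoint) auto
      also have "\<dots> \<le> real m"
        using U unfolding m_def of_nat_le_iff by (intro card_mono) auto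
      finally show "(\<Sum>u\<in>?k ` {..<l}. ?w u) \<le> real m" .
      show "real (card {j \<in> {..<l}. r (as ! j) = u}) \<le> g" for u
        using as by (simp add: A_def)
    qed (use l m in auto)
    moreover have "real (card (B r as)) \<le> (\<Prod>j<l. ?w (?k j))"
      using B[of r as] by (simp add: b_def flip: of_nat_prod)
    ultimately show ?thesis
      by simp
  qed
  let ?S = "SIGMA r:R. SIGMA as:A r. B r as"
  have finS: "finite ?S"
    using finR finA B by auto
  have "{\<tau>s \<in> pure_tuples n l. moved_points \<tau>s = U \<and> \<tau>s \<in> small_components n g} \<subseteq> f ` ?S"
  proof
    fix \<tau>s assume "\<tau>s \<in> {\<tau>s \<in> pure_tuples n l. moved_points \<tau>s = U \<and> \<tau>s \<in> small_components n g}"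
    then have \<tau>s: "\<tau>s \<in> pure_tuples n l" and mU: "moved_points \<tau>s = U"
      and small: "\<tau>s \<in> small_components n g"
      by auto
    have len: "length \<tau>s = l"
      using \<tau>s by (simp add: pure_tuples_def)
    define K where "K v = (map_adj \<tau>s)\<^sup>* `` {v}" for v
    have KU: "K v \<subseteq> U" if "v \<in> U" for v
      using component_subset[of \<tau>s v] that mU by (auto simp: K_def)
    \<comment> \<open>The minimum is a canonical representative, constant on each component; the
      restriction to \<open>U\<close> places \<open>r\<close> in the extensional function space
      \<open>R\<close>.\<close>
    define r where "r = restrict (\<lambda>v. Min (K v)) U"
    have rK: "r v \<in> K v" if "v \<in> U" for v
    proof -
      have "finite (K v)" "K v \<noteq> {}"
        using KU[OF that] U finite_subset by (auto simp: K_def)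
      then show ?thesis
        using Min_in[of "K v"] that by (simp add: r_def)
    qed
    have rU: "r v \<in> U" "K (r v) = K v" if "v \<in> U" for v
      using rK[OF that] KU[OF that] component_eqI[of v "r v" \<tau>s] by (auto simp: K_def)
    have "r \<in> R"
      using rU by (auto simp: R_def r_def)
    have "\<exists>p. \<forall>j<l. \<tau>s ! j = Transposition.transpose (fst (p j)) (snd (p j)) \<and> fst (p j) \<noteq> snd (p j) \<and>
        edge_ends \<tau>s j = {fst (p j), snd (p j)}"
    proof (rule choice_iff'[THEN iffD1], intro allI impI)
      fix j assume "j < l"
      from pure_tuples_nth[OF \<tau>s this]
      show "\<exists>p. \<tau>s ! j = Transposition.transpose (fst p) (snd p) \<and> fst p \<noteq> snd p \<and>
          edge_ends \<tau>s j = {fst p, snd p}"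
        by (metis fst_conv snd_conv)
    qed
    then obtain p where p: "\<And>j. j < l \<Longrightarrow> \<tau>s ! j = Transposition.transpose (fst (p j)) (snd (p j))"
      "\<And>j. j < l \<Longrightarrow> fst (p j) \<noteq> snd (p j)" "\<And>j. j < l \<Longrightarrow> edge_ends \<tau>s j = {fst (p j), snd (p j)}"
      by blast
    define as where "as = map (\<lambda>j. fst (p j)) [0..<l]"
    define bs where "bs = map (\<lambda>j. snd (p j)) [0..<l]"
    have pU: "fst (p j) \<in> U" "snd (p j) \<in> U" if "j < l" for j
      using p(3)[OF that] that mU len by (auto simp: moved_points_def)
    have pK: "K (fst (p j)) = K (snd (p j))" if "j < l" for j
    proof -
      have "(fst (p j), snd (p j)) \<in> map_adj \<tau>s"
        unfolding map_adj_iff using p(2,3)[OF that] that len by blast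
      then show ?thesis
        unfolding K_def by (intro component_eqI r_into_rtrancl)
    qed
    have "as \<in> A r"
    proof -
      have "real (card {j. j < l \<and> r (as ! j) = u}) \<le> g" for u
      proof (cases "\<exists>j<l. r (as ! j) = u")
        case True
        then have uU: "u \<in> U"
          using pU rU by (auto simp: as_def)
        have "{j. j < l \<and> r (as ! j) = u} \<subseteq> component_edges \<tau>s (K u)"
        proof
          fix j assume "j \<in> {j. j < l \<and> r (as ! j) = u}"
          then have j: "j < l" and "r (fst (p j)) = u"
            by (auto simp: as_def)
          then have "K u = K (fst (p j))"
            using rU(2)[OF pU(1)] by auto
          then have "fst (p j) \<in> K u" "snd (p j) \<in> K u"
            using pK[OF j] by (auto simp: K_def)
          then show "j \<in> component_edges \<tau>s (K u)"
            using j len p(3)[OF j] by (simp add: component_edges_def)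
        qed
        then have "card {j. j < l \<and> r (as ! j) = u} \<le> card (component_edges \<tau>s (K u))"
          by (intro card_mono) (auto simp: component_edges_def)
        moreover have "u \<in> {1..n}"
          using uU mU moved_points_subset[OF \<tau>s] by auto
        then have "K u \<in> map_components n \<tau>s"
          by (simp add: K_def map_components_def quotientI)
        then have "real (card (component_edges \<tau>s (K u))) \<le> g"
          using small by (simp add: small_components_def)
        ultimately show ?thesis
          by linarith
      next
        case False
        then have "{j. j < l \<and> r (as ! j) = u} = {}"
          by auto
        then show ?thesis
          using g by (metis card.empty of_nat_0)
      qed
      then show ?thesis
        using pU by (auto simp: A_def as_def)
    qed
    moreover have "bs \<in> B r as"
      using pU pK by (auto simp: B_def b_def as_def bs_def r_def)
    moreover have "\<tau>s = f (r, as, bs)"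
      by (rule nth_equalityI) (auto simp: f_def as_def bs_def len p(1) split_beta)
    ultimately show "\<tau>s \<in> f ` ?S"
      using \<open>r \<in> R\<close> by blast
  qed
  then have "card {\<tau>s \<in> pure_tuples n l. moved_points \<tau>s = U \<and> \<tau>s \<in> small_components n g} \<le> card ?S"
    using finS by (meson card_image_le card_mono finite_imageI le_trans)
  also have "\<dots> = (\<Sum>r\<in>R. \<Sum>as\<in>A r. card (B r as))"
    using finR finA B by (simp add: card_SigmaI)
  finally have "real (card {\<tau>s \<in> pure_tuples n l. moved_points \<tau>s = U \<and> \<tau>s \<in> small_components n g})
      \<le> (\<Sum>r\<in>R. \<Sum>as\<in>A r. real (card (B r as)))"
    by (simp flip: of_nat_sum)
  also have "\<dots> \<le> (\<Sum>r\<in>R. \<Sum>as\<in>A r. (real m * g / real l) ^ l)"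
    by (intro sum_mono cardB)
  also have "\<dots> = (\<Sum>r\<in>R. real (card (A r)) * (real m * g / real l) ^ l)"
    by simp
  also have "\<dots> \<le> (\<Sum>r\<in>R. real (m ^ l) * (real m * g / real l) ^ l)"
    using cardA g by (intro sum_mono mult_right_mono) (auto simp flip: of_nat_power)
  also have "\<dots> = real m ^ m * real m ^ l * (real m * g / real l) ^ l"
    by (simp add: cardR)
  finally show ?thesis
    by (simp add: m_def)
qed

section \<open>Numerical estimates against \<open>(n / ln n) ^ (2 * l)\<close>\<close>

text \<open>The Cauchy-Schwarz bound is used with \<open>q\<close> the integer part of
  \<open>n / ln n\<close>. This size is chosen so that
  \<open>fact q \<le> n ^ q \<le> exp n\<close>, while \<open>q choose 2\<close> is still of order
  \<open>(n / ln n) ^ 2\<close>.\<close>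

lemma card_pure_tuples_ge_ratio:
  fixes n l :: nat
  assumes "even l" and ln: "ln (real n) \<ge> 1" and x: "real n / ln (real n) \<ge> 4"
  shows "(real n / ln (real n)) ^ (2 * l) \<le> real (card (pure_tuples n l)) * 16 ^ l * exp (real n)"
proof -
  define x where "x = real n / ln (real n)"
  define q where "q = nat \<lfloor>x\<rfloor>"
  have n: "n > 0"
    using ln by (cases "n = 0") auto
  have x4: "x \<ge> 4"
    using x by (simp add: x_def)
  have q: "real q \<le> x" "x - 1 \<le> real q"
    using x4 unfolding q_def by linarith+
  have "x \<le> real n"
    using ln n by (simp add: x_def divide_le_eq mult_le_cancel_left1)
  then have qn: "q \<le> n"
    using q by linarith
  have q1: "q \<ge> 1"
    using q x4 by linarith
  have choose: "real (q choose 2) = real q * (real q - 1) / 2"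
    using q1 by (simp add: choose_two real_of_nat_div of_nat_diff)
  \<comment> \<open>From \<open>x \<ge> 4\<close> it follows that
    \<open>x / 2 \<le> x - 2 \<le> q - 1\<close>, so both \<open>q\<close> and \<open>q - 1\<close>
    are at least \<open>x / 2\<close>.\<close>
  have "x\<^sup>2 / 16 \<le> (x / 2) * (x / 2) / 2"
    by (simp add: power2_eq_square)
  also have "\<dots> \<le> real (q choose 2)"
    unfolding choose using q x4 by (intro divide_right_mono mult_mono) auto
  finally have "(x\<^sup>2 / 16) ^ l \<le> real (q choose 2) ^ l"
    by (intro power_mono) auto
  also have "\<dots> \<le> real (card (pure_tuples n l)) * fact q"
    using card_pure_tuples_ge[OF assms(1) qn] by (metis of_nat_fact of_nat_le_iff of_nat_mult of_nat_power)
  also have "\<dots> \<le> real (card (pure_tuples n l)) * exp (real n)"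
  proof (rule mult_left_mono)
    have "(fact q :: real) \<le> real (q ^ q)"
      by (metis fact_le_power le_refl of_nat_fact of_nat_le_iff)
    also have "\<dots> \<le> real n ^ q"
      using qn by (simp add: power_mono)
    also have "\<dots> = exp (real q * ln (real n))"
      using n by (simp add: exp_of_nat_mult)
    also have "\<dots> \<le> exp (x * ln (real n))"
      using q ln by (simp add: mult_right_mono)
    also have "x * ln (real n) = real n"
      using ln by (simp add: x_def)
    finally show "(fact q :: real) \<le> exp (real n)" .
  qed simp
  finally have "x ^ (2 * l) / 16 ^ l \<le> real (card (pure_tuples n l)) * exp (real n)"
    by (simp add: power_divide power_mult)
  then show ?thesis
    unfolding x_def[symmetric] by (simp add: pos_divide_le_eq mult_ac)
qed

text \<open>
  With \<open>x = m * ln n / n\<close>, the left-hand side is, up to \<open>exp (O(n))\<close>, at most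
  \<open>(n / ln n) ^ (2 l) * x ^ (2 l) * exp (- x n / 4)\<close>.
\<close>

lemma large_support_bound:
  fixes n l m :: nat and \<theta> K :: real
  assumes \<theta>: "\<theta> > 1" and K: "K = 8 * (12 * \<theta> + 3 + 6 * \<theta> * ln (48 * \<theta>))"
    and l: "real l \<le> 3 * \<theta> * real n"
    and ln: "ln (real n) \<ge> 1" and sq: "sqrt (real n) \<le> real n / ln (real n)"
    and m: "K * (real n / ln (real n)) < real m"
  shows "2 ^ l * real m ^ (2 * l) / sqrt (real m) ^ m * (16 ^ l * exp (real n) * 2 ^ n)
    \<le> exp (- real n) * (real n / ln (real n)) ^ (2 * l)"
proof -
  define a where "a = real n / ln (real n)"
  define x where "x = real m / a"
  have n: "n > 0"
    using ln by (cases "n = 0") auto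
  have a: "a > 0"
    unfolding a_def by (intro divide_pos_pos) (use n ln in linarith)+
  have l48: "ln (48 * \<theta>) > 0"
    using \<theta> by simp
  have K1: "K \<ge> 1"
    using \<theta> l48 by (simp add: K)
  have xK: "x > K"
    using m a unfolding x_def a_def[symmetric] by (simp add: pos_less_divide_eq)
  have x1: "x \<ge> 1"
    using xK K1 by simp
  have mx: "real m = x * a"
    using a by (simp add: x_def)
  have man: "real m * ln (real n) = x * real n"
    using ln by (simp add: mx a_def)
  \<comment> \<open>This makes \<open>ln m\<close> at least half of \<open>ln n\<close>. Hence
    \<open>sqrt m ^ m\<close>, the gain from purity, is at least
    \<open>exp (m * ln n / 4) = exp (x * n / 4)\<close>.\<close>
  have "sqrt (real n) \<le> real m"
    using sq x1 a by (simp add: mx a_def[symmetric]) (metis mult_le_cancel_right1 order_trans not_less order_less_imp_le)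
  then have "ln (sqrt (real n)) \<le> ln (real m)"
    using n by (intro ln_mono) (auto intro: less_le_trans[of 0 "sqrt (real n)"])
  then have lnm: "ln (real n) / 2 \<le> ln (real m)"
    using n by (simp add: ln_sqrt)
  have m0: "real m > 0"
    using mx x1 a by simp
  have "x * real n / 4 = real m * (ln (real n) / 2) / 2"
    using man by simp
  also have "\<dots> \<le> real m * ln (real m) / 2"
    using lnm by (intro divide_right_mono mult_left_mono) auto
  also have "\<dots> = real m * ln (sqrt (real m))"
    using m0 by (simp add: ln_sqrt)
  finally have "exp (x * real n / 4) \<le> exp (real m * ln (sqrt (real m)))"
    by simp
  also have "\<dots> = sqrt (real m) ^ m"
    using m0 by (simp add: exp_of_nat_mult)
  finally have sqm: "exp (x * real n / 4) \<le> sqrt (real m) ^ m" .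
  \<comment> \<open>The scale \<open>48 * \<theta>\<close> is chosen so that, with
    \<open>2 * l \<le> 6 * \<theta> * n\<close>, the linear term becomes \<open>x * n / 8\<close>,
    half of the gain \<open>x * n / 4\<close>.\<close>
  have "ln x = ln (x / (48 * \<theta>)) + ln (48 * \<theta>)"
    using x1 \<theta> by (simp add: ln_div)
  also have "ln (x / (48 * \<theta>)) \<le> x / (48 * \<theta>)"
    using x1 \<theta> by (intro less_imp_le ln_less_self divide_pos_pos) auto
  finally have lnx: "ln x \<le> x / (48 * \<theta>) + ln (48 * \<theta>)"
    by simp
  have "real (2 * l) * ln x \<le> (6 * \<theta> * real n) * (x / (48 * \<theta>) + ln (48 * \<theta>))"
    using l lnx x1 \<theta> by (intro mult_mono) auto
  also have "\<dots> = real n * (x / 8 + 6 * \<theta> * ln (48 * \<theta>))"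
    using \<theta> by (simp add: field_simps)
  finally have "exp (real (2 * l) * ln x) \<le> exp (real n * (x / 8 + 6 * \<theta> * ln (48 * \<theta>)))"
    by simp
  then have x2l: "x ^ (2 * l) \<le> exp (real n * (x / 8 + 6 * \<theta> * ln (48 * \<theta>)))"
    using x1 by (simp only: exp_of_nat_mult exp_ln)
  have two: "2 \<le> exp (1::real)"
    using exp_ge_add_one_self[of 1] by simp
  \<comment> \<open>With \<open>l \<le> 3 * \<theta> * n\<close> this turns \<open>32 ^ l\<close>
    into \<open>exp (12 * \<theta> * n)\<close>, the source of the summand
    \<open>12 * \<theta>\<close> in \<open>K\<close>.\<close>
  have e4: "32 \<le> exp (4::real)"
  proof -
    have "(32::real) \<le> (5 / 2) ^ 4"
      by (simp add: power_numeral_reduce)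
    also have "\<dots> \<le> exp 1 ^ 4"
      using exp_lower_Taylor_quadratic[of 1] by (intro power_mono) auto
    also have "\<dots> = exp 4"
      by (simp flip: exp_of_nat_mult)
    finally show ?thesis .
  qed
  have "(2 ^ l * 16 ^ l :: real) = 32 ^ l"
    by (simp flip: power_mult_distrib)
  also have "\<dots> \<le> exp 4 ^ l"
    using e4 by (intro power_mono) auto
  also have "\<dots> = exp (real l * 4)"
    by (simp add: exp_of_nat_mult)
  also have "\<dots> \<le> exp (12 * \<theta> * real n)"
    using l by simp
  finally have p32: "(2 ^ l * 16 ^ l :: real) \<le> exp (12 * \<theta> * real n)" .
  have p2: "(2 ^ n :: real) \<le> exp (real n)"
    using power_mono[OF two, of n] by (simp add: exp_of_nat_mult[of n 1, simplified])
  have "2 ^ l * real m ^ (2 * l) / sqrt (real m) ^ m * (16 ^ l * exp (real n) * 2 ^ n)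
      = a ^ (2 * l) * ((2 ^ l * 16 ^ l) * exp (real n) * 2 ^ n * x ^ (2 * l) / sqrt (real m) ^ m)"
    unfolding mx by (simp add: power_mult_distrib)
  also have "\<dots> \<le> a ^ (2 * l) * (exp (12 * \<theta> * real n) * exp (real n) * exp (real n) *
      exp (real n * (x / 8 + 6 * \<theta> * ln (48 * \<theta>))) / exp (x * real n / 4))"
    using p32 p2 x2l sqm a x1 by (intro mult_left_mono frac_le mult_mono) auto
  also have "\<dots> = a ^ (2 * l) * exp (real n * (12 * \<theta> + 2 + 6 * \<theta> * ln (48 * \<theta>) - x / 8))"
    by (simp add: algebra_simps flip: exp_add exp_diff)
  \<comment> \<open>The choice of \<open>K\<close> enters here: \<open>x / 8 > K / 8\<close> exceeds
    the sum of the remaining constants by more than 1.\<close>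
  also have "\<dots> \<le> a ^ (2 * l) * exp (real n * (- 1))"
    using xK a unfolding K by (intro mult_left_mono iffD2[OF exp_le_cancel_iff]) auto
  finally show ?thesis
    by (simp add: a_def mult.commute)
qed

text \<open>For \<open>m \<le> K * n / ln n\<close> the number \<open>m ^ m\<close> of choices of
  representatives is only \<open>exp (K * n)\<close>. The value of \<gamma> gives
  \<open>(16 * K^2 * \<gamma>) ^ l \<le> exp (- (K + 3) * n)\<close>, which absorbs
  \<open>exp (K * n)\<close>, \<open>exp n\<close> and \<open>2 ^ n\<close> and leaves
  \<open>exp (- n)\<close>.\<close>

lemma small_components_bound:
  fixes n l m :: nat and \<gamma> K :: real
  assumes K: "K \<ge> 1" and \<gamma>: "\<gamma> = exp (- (K + 3)) / (16 * K\<^sup>2)"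
    and l: "n \<le> l" and mn: "m \<le> n" and ln: "ln (real n) \<ge> 1"
    and m: "real m \<le> K * (real n / ln (real n))"
  shows "real m ^ m * real m ^ l * (real m * \<gamma>) ^ l * (16 ^ l * exp (real n) * 2 ^ n)
    \<le> exp (- real n) * (real n / ln (real n)) ^ (2 * l)"
proof -
  define a where "a = real n / ln (real n)"
  have n: "n > 0"
    using ln by (cases "n = 0") auto
  have a: "a > 0"
    unfolding a_def by (intro divide_pos_pos) (use n ln in linarith)+
  have two: "2 \<le> exp (1::real)"
    using exp_ge_add_one_self[of 1] by simp
  have p2: "(2 ^ n :: real) \<le> exp (real n)"
    using power_mono[OF two, of n] by (simp add: exp_of_nat_mult[of n 1, simplified])
  have "real m ^ m \<le> real n ^ m"
    using mn by (simp add: power_mono)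
  also have "\<dots> = exp (real m * ln (real n))"
    using n by (simp add: exp_of_nat_mult)
  also have "\<dots> \<le> exp (K * a * ln (real n))"
    using m ln by (simp add: a_def[symmetric] mult_right_mono)
  also have "K * a * ln (real n) = K * real n"
    using ln by (simp add: a_def)
  finally have mm: "real m ^ m \<le> exp (K * real n)" .
  have m2l: "real m ^ (2 * l) \<le> (K * a) ^ (2 * l)"
    using m by (intro power_mono) (auto simp: a_def)
  have \<gamma>l: "(16 * K\<^sup>2 * \<gamma>) ^ l \<le> exp (- (K + 3) * real n)"
  proof -
    have "(16 * K\<^sup>2 * \<gamma>) ^ l = exp (- (K + 3)) ^ l"
      using K by (simp add: \<gamma>)
    also have "\<dots> = exp (- (K + 3) * real l)"
      by (metis exp_of_nat_mult mult.commute)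
    also have "\<dots> \<le> exp (- (K + 3) * real n)"
      using K l by simp
    finally show ?thesis .
  qed
  have \<gamma>0: "\<gamma> > 0"
    using K by (simp add: \<gamma>)
  have "real m ^ m * real m ^ l * (real m * \<gamma>) ^ l * (16 ^ l * exp (real n) * 2 ^ n)
      = real m ^ m * real m ^ (2 * l) * (\<gamma> ^ l * 16 ^ l * exp (real n) * 2 ^ n)"
    by (simp add: power_mult_distrib power_mult power2_eq_square)
  also have "\<dots> \<le> exp (K * real n) * (K * a) ^ (2 * l) * (\<gamma> ^ l * 16 ^ l * exp (real n) * exp (real n))"
    using mm m2l p2 \<gamma>0 K a by (intro mult_mono) auto
  also have "\<dots> = a ^ (2 * l) * (exp (K * real n) * (16 * K\<^sup>2 * \<gamma>) ^ l * exp (real n) * exp (real n))"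
    by (simp add: power_mult_distrib power_mult)
  also have "\<dots> \<le> a ^ (2 * l) * (exp (K * real n) * exp (- (K + 3) * real n) * exp (real n) * exp (real n))"
    using \<gamma>l a by (intro mult_mono mult_left_mono) (auto simp: \<gamma>0 less_imp_le)
  also have "\<dots> = a ^ (2 * l) * exp (- real n)"
    by (simp add: algebra_simps flip: exp_add)
  finally show ?thesis
    by (simp add: a_def mult.commute)
qed

section \<open>Exceptional tuples are exponentially rare\<close>

text \<open>One bad event serves both assertions: a pure tuple outside it moves few points, hence
  has no large vertex component, and has a component with many edges.\<close>

definition exceptional :: "nat \<Rightarrow> nat \<Rightarrow> real \<Rightarrow> real \<Rightarrow> (nat \<Rightarrow> nat) list set" where
  "exceptional n l K \<gamma> = {\<tau>s \<in> pure_tuples n l.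
     K * (real n / ln (real n)) < real (card (moved_points \<tau>s)) \<or>
     \<tau>s \<in> small_components n (\<gamma> * real l)}"

text \<open>Union bound over the \<open>2 ^ n\<close> possible sets \<open>U\<close> of moved
  points. Each contributes at most a fraction \<open>exp (- n) / 2 ^ n\<close> of all pure tuples:
  large \<open>U\<close> because of the cost of purity, the others because of the cost of small
  components.\<close>

lemma card_exceptional_le:
  fixes n l :: nat and \<theta> K \<gamma> :: real
  assumes \<theta>: "\<theta> > 1" and K: "K = 8 * (12 * \<theta> + 3 + 6 * \<theta> * ln (48 * \<theta>))"
    and \<gamma>: "\<gamma> = exp (- (K + 3)) / (16 * K\<^sup>2)"
    and l: "even l" "n \<le> l" "real l \<le> 3 * \<theta> * real n"
    and n: "ln (real n) \<ge> 1" "sqrt (real n) \<le> real n / ln (real n)" "real n / ln (real n) \<ge> 4"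
  shows "real (card (exceptional n l K \<gamma>)) \<le> exp (- real n) * real (card (pure_tuples n l))"
proof -
  have n0: "n > 0"
    using n(1) by (cases "n = 0") auto
  have l0: "l > 0"
    using l n0 by simp
  have K1: "K \<ge> 1"
    using \<theta> by (simp add: K)
  \<comment> \<open>The factors \<open>16 ^ l * exp n\<close> are the loss in the lower bound for
    pure tuples; \<open>2 ^ n\<close> pays for the union over \<open>U\<close>.\<close>
  define D where "D = (16 ^ l * exp (real n) * 2 ^ n :: real)"
  have D: "D > 0"
    by (simp add: D_def)
  define E where "E U = {\<tau>s \<in> exceptional n l K \<gamma>. moved_points \<tau>s = U}" for U
  have fin: "finite (E U)" for U
    using finite_pure_tuples[of n l] by (simp add: E_def exceptional_def)
  have E: "real (card (E U)) \<le> exp (- real n) * real (card (pure_tuples n l)) / 2 ^ n"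
    if U: "U \<subseteq> {1..n}" for U
  proof -
    have finU: "finite U" and cardU: "card U \<le> n"
      using U finite_subset card_mono[OF _ U] by auto
    have "real (card (E U)) * D \<le> exp (- real n) * (real n / ln (real n)) ^ (2 * l)"
    proof (cases "K * (real n / ln (real n)) < real (card U)")
      case True
      have "card (E U) \<le> card {\<tau>s \<in> pure_tuples n l. moved_points \<tau>s = U}"
        by (rule card_mono) (auto simp: finite_pure_tuples E_def exceptional_def)
      then have "real (card (E U)) \<le> 2 ^ l * real (card U) ^ (2 * l) / sqrt (real (card U)) ^ card U"
        using card_pure_tuples_moved_points_le[OF finU, of n l] by linarith
      then have "real (card (E U)) * D \<le>
          2 ^ l * real (card U) ^ (2 * l) / sqrt (real (card U)) ^ card U * D"
        using D by (intro mult_right_mono) auto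
      then show ?thesis
        using large_support_bound[OF \<theta> K l(3) n(1,2) True] by (simp add: D_def)
    next
      case False
      show ?thesis
      \<comment> \<open>The count by components requires a nonempty \<open>U\<close>; since
        \<open>l > 0\<close>, every pure tuple moves some point.\<close>
      proof (cases "U = {}")
        case True
        have "E U = {}"
        proof -
          have "edge_ends \<tau>s 0 \<noteq> {}" "edge_ends \<tau>s 0 \<subseteq> moved_points \<tau>s"
            if "\<tau>s \<in> pure_tuples n l" for \<tau>s
            using pure_tuples_nth[OF that l0] that l0 by (auto simp: moved_points_def pure_tuples_def)
          then show ?thesis
            using True by (fastforce simp: E_def exceptional_def)
        qed
        then show ?thesis
          using n by simp
      next
        case U0: False
        have "\<gamma> \<ge> 0"
          by (simp add: \<gamma>)
        have "card (E U) \<le> card {\<tau>s \<in> pure_tuples n l. moved_points \<tau>s = U \<and>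
            \<tau>s \<in> small_components n (\<gamma> * real l)}"
          using False by (intro card_mono) (auto simp: finite_pure_tuples E_def exceptional_def)
        then have "real (card (E U)) \<le> real (card U) ^ card U * real (card U) ^ l * (real (card U) * \<gamma>) ^ l"
          using card_small_components_le[OF finU U0 l0, of "\<gamma> * real l" n] l0 \<open>\<gamma> \<ge> 0\<close> by simp
        then have "real (card (E U)) * D \<le>
            real (card U) ^ card U * real (card U) ^ l * (real (card U) * \<gamma>) ^ l * D"
          using D by (intro mult_right_mono) auto
        also have "\<dots> \<le> exp (- real n) * (real n / ln (real n)) ^ (2 * l)"
          unfolding D_def by (rule small_components_bound[OF K1 \<gamma> l(2) cardU n(1)]) (use False in linarith)
        finally show ?thesis .
      qed
    qed
    also have "\<dots> \<le> exp (- real n) * (real (card (pure_tuples n l)) * 16 ^ l * exp (real n))"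
      using card_pure_tuples_ge_ratio[OF l(1) n(1,3)] by simp
    also have "\<dots> = (exp (- real n) * real (card (pure_tuples n l)) / 2 ^ n) * D"
      by (simp add: D_def)
    finally show ?thesis
      using D by (rule mult_right_le_imp_le)
  qed
  have "exceptional n l K \<gamma> \<subseteq> (\<Union>U\<in>Pow {1..n}. E U)"
    using moved_points_subset[of _ n l] by (auto simp: E_def exceptional_def)
  then have "card (exceptional n l K \<gamma>) \<le> card (\<Union>U\<in>Pow {1..n}. E U)"
    using fin by (intro card_mono) auto
  also have "\<dots> \<le> (\<Sum>U\<in>Pow {1..n}. card (E U))"
    by (rule card_UN_le) simp
  finally have "real (card (exceptional n l K \<gamma>)) \<le> (\<Sum>U\<in>Pow {1..n}. real (card (E U)))"
    by (simp flip: of_nat_sum)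
  also have "\<dots> \<le> (\<Sum>U\<in>Pow {1..n}. exp (- real n) * real (card (pure_tuples n l)) / 2 ^ n)"
    by (rule sum_mono) (use E in auto)
  also have "\<dots> = exp (- real n) * real (card (pure_tuples n l))"
    by (simp add: card_Pow)
  finally show ?thesis .
qed

section \<open>Probabilistic conclusions\<close>

text \<open>The ratio of \<open>l n\<close> to \<open>2 * \<theta> * n\<close> tends to 1, so it is
  eventually between \<open>1 / 2\<close> and \<open>3 / 2\<close>; then \<open>\<theta> > 1\<close>
  gives the lower bound \<open>n\<close>.\<close>

lemma eventually_between_of_asymp_equiv:
  fixes l :: "nat \<Rightarrow> nat"
  assumes \<theta>: "\<theta> > 1" and l: "(\<lambda>n. real (l n)) \<sim>[sequentially] (\<lambda>n. 2 * \<theta> * real n)"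
  shows "eventually (\<lambda>n. n \<le> l n \<and> real (l n) \<le> 3 * \<theta> * real n) sequentially"
proof -
  have "eventually (\<lambda>n. real (l n) \<noteq> 0 \<or> 2 * \<theta> * real n \<noteq> 0) sequentially"
    using eventually_gt_at_top[of 0] by eventually_elim (use \<theta> in auto)
  then have lim: "(\<lambda>n. real (l n) / (2 * \<theta> * real n)) \<longlonglongrightarrow> 1"
    using l by (rule asymp_equivD_strong[rotated])
  have "eventually (\<lambda>n. 1 / 2 < real (l n) / (2 * \<theta> * real n)) sequentially"
    "eventually (\<lambda>n. real (l n) / (2 * \<theta> * real n) < 3 / 2) sequentially"
    by (rule order_tendstoD[OF lim]; simp)+
  then show ?thesis
    using eventually_gt_at_top[of 0]
  proof eventually_elim
    case (elim n)
    have pos: "2 * \<theta> * real n > 0"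
      using \<theta> elim by simp
    have "\<theta> * real n < real (l n)" "real (l n) < 3 * \<theta> * real n"
      using elim pos by (simp_all add: field_simps)
    moreover have "real n \<le> \<theta> * real n"
      using \<theta> by (simp add: mult_le_cancel_right1)
    ultimately show ?case
      by linarith
  qed
qed

theorem theorem1p5:
  fixes \<theta> :: real
  assumes "\<theta> > 1"
  shows "\<exists>\<gamma>>0. \<forall>l :: nat \<Rightarrow> nat.
    (\<forall>n. even (l n)) \<and> (\<lambda>n. real (l n)) \<sim>[sequentially] (\<lambda>n. 2 * \<theta> * real n) \<longrightarrow>
    (\<lambda>n. measure_pmf.prob (random_pure_tuple n (l n))
       {\<tau>s. \<exists>C\<in>map_components n \<tau>s. real (card (component_edges \<tau>s C)) \<ge> \<gamma> * real (l n)})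
      \<longlonglongrightarrow> 1 \<and>
    big_O_in_prob (\<lambda>n. random_pure_tuple n (l n))
      (\<lambda>n \<tau>s. real (max_component_vertices n \<tau>s)) (\<lambda>n. real n / ln (real n))"
proof -
  \<comment> \<open>Both constants depend on \<theta> alone, as they must, since \<gamma> is chosen
    before the sequence \<open>l\<close>.\<close>
  define K where "K = 8 * (12 * \<theta> + 3 + 6 * \<theta> * ln (48 * \<theta>))"
  define \<gamma> where "\<gamma> = exp (- (K + 3)) / (16 * K\<^sup>2)"
  have K1: "K \<ge> 1"
    using assms by (simp add: K_def)
  have "\<gamma> > 0"
    using K1 by (simp add: \<gamma>_def)
  show ?thesis
  proof (intro exI[of _ \<gamma>] conjI \<open>\<gamma> > 0\<close> allI impI; (elim conjE)?)
    fix l :: "nat \<Rightarrow> nat"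
    assume even: "\<forall>n. even (l n)"
      and asymp: "(\<lambda>n. real (l n)) \<sim>[sequentially] (\<lambda>n. 2 * \<theta> * real n)"
    let ?P = "\<lambda>n. measure_pmf.prob (random_pure_tuple n (l n))"
    \<comment> \<open>Stated for an arbitrary event \<open>A\<close> containing the unexceptional
      pure tuples, so that it yields both the large component and the tightness.\<close>
    have bound: "1 - exp (- real n) \<le> ?P n A"
      if ex: "real (card (exceptional n (l n) K \<gamma>)) \<le> exp (- real n) * real (card (pure_tuples n (l n)))"
        and n: "n \<ge> 2" and A: "pure_tuples n (l n) - exceptional n (l n) K \<gamma> \<subseteq> A" for n A
    proof -
      have ne: "pure_tuples n (l n) \<noteq> {}" and fin: "finite (pure_tuples n (l n))"
        using pure_tuples_nonempty n even finite_pure_tuples by auto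
      then have N: "real (card (pure_tuples n (l n))) > 0"
        by (simp add: card_gt_0_iff)
      have sub: "exceptional n (l n) K \<gamma> \<subseteq> pure_tuples n (l n)"
        by (auto simp: exceptional_def)
      have "card (pure_tuples n (l n) - exceptional n (l n) K \<gamma>) \<le> card (pure_tuples n (l n) \<inter> A)"
        using fin A by (intro card_mono) auto
      then have "real (card (pure_tuples n (l n))) - real (card (exceptional n (l n) K \<gamma>))
          \<le> real (card (pure_tuples n (l n) \<inter> A))"
        using card_Diff_subset[OF finite_subset[OF sub fin] sub] by linarith
      then have "(1 - exp (- real n)) * real (card (pure_tuples n (l n))) \<le> real (card (pure_tuples n (l n) \<inter> A))"
        using ex by (simp add: algebra_simps)
      then have "1 - exp (- real n) \<le> real (card (pure_tuples n (l n) \<inter> A)) / real (card (pure_tuples n (l n)))"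
        using N by (simp add: pos_le_divide_eq)
      then show ?thesis
        by (simp add: random_pure_tuple_def measure_pmf_of_set[OF ne fin])
    qed
    have "eventually (\<lambda>n. ln (real n) \<ge> 1) sequentially"
      "eventually (\<lambda>n. sqrt (real n) \<le> real n / ln (real n)) sequentially"
      "eventually (\<lambda>n. real n / ln (real n) \<ge> 4) sequentially"
      by real_asymp+
    then have ev: "eventually (\<lambda>n. real (card (exceptional n (l n) K \<gamma>))
        \<le> exp (- real n) * real (card (pure_tuples n (l n))) \<and> n \<ge> 2 \<and> real n / ln (real n) \<ge> 4) sequentially"
      using eventually_between_of_asymp_equiv[OF assms asymp] eventually_ge_at_top[of 2]
      by eventually_elim (use card_exceptional_le[OF assms K_def \<gamma>_def] even in auto)
    let ?A = "\<lambda>n. {\<tau>s. \<exists>C\<in>map_components n \<tau>s. real (card (component_edges \<tau>s C)) \<ge> \<gamma> * real (l n)}"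
    show "(\<lambda>n. ?P n (?A n)) \<longlonglongrightarrow> 1"
    proof (rule tendsto_sandwich)
      show "eventually (\<lambda>n. 1 - exp (- real n) \<le> ?P n (?A n)) sequentially"
        using ev
      proof eventually_elim
        case (elim n)
        show ?case
        proof (rule bound)
          show "pure_tuples n (l n) - exceptional n (l n) K \<gamma> \<subseteq> ?A n"
            by (auto simp: exceptional_def small_components_def not_le intro: less_imp_le)
        qed (use elim in auto)
      qed
      show "(\<lambda>n. 1 - exp (- real n)) \<longlonglongrightarrow> 1"
        by real_asymp
    qed auto
    let ?X = "\<lambda>n \<tau>s. real (max_component_vertices n \<tau>s) / (real n / ln (real n))"
    show "big_O_in_prob (\<lambda>n. random_pure_tuple n (l n))
      (\<lambda>n \<tau>s. real (max_component_vertices n \<tau>s)) (\<lambda>n. real n / ln (real n))"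
      unfolding big_O_in_prob_def tight_def
    proof (intro conjI allI impI)
      show "real_distribution (distr (measure_pmf (random_pure_tuple n (l n))) borel (?X n))" for n
        by (rule prob_space.real_distribution_distr[OF measure_pmf.prob_space_axioms]) simp
    next
      fix \<epsilon> :: real assume \<epsilon>: "\<epsilon> > 0"
      have "eventually (\<lambda>n. exp (- real n) < \<epsilon>) sequentially"
        by (rule order_tendstoD(2)[OF _ \<epsilon>]) real_asymp
      with ev have "eventually (\<lambda>n. exp (- real n) < \<epsilon> \<and> n \<ge> 2 \<and> real n / ln (real n) \<ge> 4 \<and>
          real (card (exceptional n (l n) K \<gamma>)) \<le> exp (- real n) * real (card (pure_tuples n (l n)))) sequentially"
        by eventually_elim auto
      then obtain n0 where n0: "\<And>n. n \<ge> n0 \<Longrightarrow> exp (- real n) < \<epsilon> \<and> n \<ge> 2 \<and> real n / ln (real n) \<ge> 4 \<and>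
          real (card (exceptional n (l n) K \<gamma>)) \<le> exp (- real n) * real (card (pure_tuples n (l n)))"
        by (auto simp: eventually_at_top_linorder)
      \<comment> \<open>\<open>K\<close> works for \<open>n \<ge> n0\<close>. For smaller
        \<open>n \<ge> 2\<close> a component has at most \<open>n\<close> vertices, so the quotient
        is at most \<open>ln n\<close>.\<close>
      define b where "b = max K (ln (real (n0 + 1)))"
      \<comment> \<open>Tightness is phrased with intervals open on the left, so the left end point
        must lie strictly below the nonnegative quotients.\<close>
      have X0: "?X n \<tau>s > - 1" for n \<tau>s
      proof -
        have "ln (real n) \<ge> 0"
          by (cases "n = 0") auto
        then have "?X n \<tau>s \<ge> 0"
          by simp
        then show ?thesis
          by linarith
      qed
      have "?P n {\<tau>s. ?X n \<tau>s \<le> b} > 1 - \<epsilon>" for n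
      proof (cases "n \<ge> n0")
        case True
        note n = n0[OF True]
        have a: "real n / ln (real n) > 0"
          using n by linarith
        have "1 - exp (- real n) \<le> ?P n {\<tau>s. ?X n \<tau>s \<le> b}"
        proof (rule bound)
          show "pure_tuples n (l n) - exceptional n (l n) K \<gamma> \<subseteq> {\<tau>s. ?X n \<tau>s \<le> b}"
          proof
            fix \<tau>s assume "\<tau>s \<in> pure_tuples n (l n) - exceptional n (l n) K \<gamma>"
            then have \<tau>s: "\<tau>s \<in> pure_tuples n (l n)"
              and m: "real (card (moved_points \<tau>s)) \<le> K * (real n / ln (real n))"
              by (auto simp: exceptional_def)
            have "finite (moved_points \<tau>s)"
              using moved_points_subset[OF \<tau>s] finite_subset by blast
            then have "max_component_vertices n \<tau>s \<le> max 1 (card (moved_points \<tau>s))"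
              using n by (intro max_component_vertices_le) auto
            \<comment> \<open>This covers the value 1 in the bound by
              \<open>max 1 (card (moved_points \<tau>s))\<close>.\<close>
            moreover have "1 * 1 \<le> K * (real n / ln (real n))"
              by (intro mult_mono) (use K1 n in linarith)+
            ultimately have "real (max_component_vertices n \<tau>s) \<le> K * (real n / ln (real n))"
              using m by linarith
            then have "?X n \<tau>s \<le> K"
              using a by (simp only: pos_divide_le_eq)
            then show "\<tau>s \<in> {\<tau>s. ?X n \<tau>s \<le> b}"
              by (simp add: b_def)
          qed
        qed (use n in auto)
        then show ?thesis
          using n by linarith
      next
        case False
        have "?P n {\<tau>s. ?X n \<tau>s \<le> b} = 1"
        proof (cases "n \<ge> 2")
          case n2: True
          have ne: "pure_tuples n (l n) \<noteq> {}" and fin: "finite (pure_tuples n (l n))"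
            using pure_tuples_nonempty n2 even finite_pure_tuples by auto
          have "?X n \<tau>s \<le> b" if \<tau>s: "\<tau>s \<in> pure_tuples n (l n)" for \<tau>s
          proof -
            have U: "moved_points \<tau>s \<subseteq> {1..n}"
              by (rule moved_points_subset[OF \<tau>s])
            then have "card (moved_points \<tau>s) \<le> n"
              using card_mono[OF _ U] by simp
            moreover have "max_component_vertices n \<tau>s \<le> max 1 (card (moved_points \<tau>s))"
              using n2 finite_subset[OF U] by (intro max_component_vertices_le) auto
            ultimately have "real (max_component_vertices n \<tau>s) \<le> real n"
              using n2 by simp
            then have "?X n \<tau>s \<le> real n / (real n / ln (real n))"
              using n2 by (intro divide_right_mono) auto
            also have "\<dots> = ln (real n)"
              using n2 by simp
            also have "\<dots> \<le> ln (real (n0 + 1))"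
              using n2 False by (intro ln_mono) auto
            finally show ?thesis
              by (simp add: b_def)
          qed
          then have "AE \<tau>s in measure_pmf (random_pure_tuple n (l n)). \<tau>s \<in> {\<tau>s. ?X n \<tau>s \<le> b}"
            using ne fin by (simp add: AE_measure_pmf_iff random_pure_tuple_def)
          then show ?thesis
            by (simp add: measure_pmf.prob_eq_1)
        next
          case False
          then have "n = 0 \<or> n = 1"
            by auto
          \<comment> \<open>Here \<open>n / ln n\<close> is 0, so the quotient is 0 by the
            convention for division by zero, whatever the distribution is.\<close>
          then have "{\<tau>s. ?X n \<tau>s \<le> b} = UNIV"
            using K1 by (auto simp: b_def)
          then show ?thesis
            using measure_pmf.prob_space[of "random_pure_tuple n (l n)"] by simp
        qed
        then show ?thesis
          using \<epsilon> by simp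
      qed
      moreover have "?X n -` {- 1<..b} = {\<tau>s. ?X n \<tau>s \<le> b}" for n
        using X0 by auto
      ultimately have "\<forall>n. measure (distr (measure_pmf (random_pure_tuple n (l n))) borel (?X n)) {- 1<..b} > 1 - \<epsilon>"
        by (simp add: measure_distr)
      moreover have "- 1 < b"
        using K1 by (simp add: b_def)
      ultimately show "\<exists>a b. a < b \<and> (\<forall>n. 1 - \<epsilon>
          < measure (distr (measure_pmf (random_pure_tuple n (l n))) borel (?X n)) {a<..b})"
        by blast
    qed
  qed
qed

end
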